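(* Let $G$ be an $(n,d,\lambda)$-graph and let $B\subseteq V(G)$ with $|B|=m$. Define $$\theta_B := \frac{m}{n}+\frac{\lambda}{d}.$$ Then for all $i\ge 2$, $$c_i(B)\le \frac{m}{i!}\,(d\theta_B)^{i-1}.$$ In particular, for $i=2$, writing $e(B)$ for the number of edges of $G$ with both endpoints in $B$, $$c_2(B)=e(B)\le \frac{dm}{2}\left(\frac{m}{n}+\frac{\lambda}{d}\right).$$
   Context: Graphs are finite and simple. An $(n,d,\lambda)$-graph is a $d$-regular graph on $n$ vertices whose adjacency matrix has eigenvalues $\lambda_1=d\ge\lambda_2\ge\dots\ge\lambda_n\ge -d$ with $|\lambda_i|\le\lambda$ for all $i\ge 2$. For $B\subseteq V(G)$, $c_i(B)$ denotes the number of subsets $K\subseteq B$ with $|K|=i$ that are cliques in $G$. *)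

theory Defs
  imports "Jordan_Normal_Form.Char_Poly" "HOL-Library.Ramsey"
begin

definition simple_graph :: "'a set \<Rightarrow> 'a set set \<Rightarrow> bool" where
  "simple_graph V E \<longleftrightarrow> finite V \<and> E \<subseteq> nsets V 2"

definition degree_in :: "'a set set \<Rightarrow> 'a \<Rightarrow> nat" where
  "degree_in E v = card {e \<in> E. v \<in> e}"

definition regular_graph :: "'a set \<Rightarrow> 'a set set \<Rightarrow> nat \<Rightarrow> bool" where
  "regular_graph V E d \<longleftrightarrow> (\<forall>v\<in>V. degree_in E v = d)"

text \<open>The rows and columns are indexed by the positions in an enumeration \<open>vs\<close> of the vertices.
  The diagonal is zero because a singleton is never an edge of a simple graph.\<close>

definition adjacency_mat :: "'a list \<Rightarrow> 'a set set \<Rightarrow> real mat" where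
  "adjacency_mat vs E = mat (length vs) (length vs)
     (\<lambda>(i, j). if {vs ! i, vs ! j} \<in> E then 1 else 0)"

text \<open>\<open>es\<close> lists the eigenvalues of \<open>A\<close>, with algebraic multiplicity, in non-increasing order.\<close>

definition ordered_spectrum :: "real mat \<Rightarrow> real list \<Rightarrow> bool" where
  "ordered_spectrum A es \<longleftrightarrow>
     char_poly A = (\<Prod>e\<leftarrow>es. [:- e, 1:]) \<and> sorted_wrt (\<ge>) es"

text \<open>The eigenvalue written \<open>\<lambda>\<^sub>i\<close> with \<open>1 \<le> i \<le> n\<close> is \<open>es ! (i - 1)\<close>.
  The enumeration of \<open>V\<close> is immaterial: reordering the vertices conjugates the adjacency
  matrix by a permutation matrix, and so does not change its characteristic polynomial.\<close>

definition ndl_graph :: "'a set \<Rightarrow> 'a set set \<Rightarrow> nat \<Rightarrow> nat \<Rightarrow> real \<Rightarrow> bool" where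
  "ndl_graph V E n d lam \<longleftrightarrow>
     simple_graph V E \<and> card V = n \<and> 0 < n \<and> regular_graph V E d \<and>
     (\<exists>vs es. distinct vs \<and> set vs = V \<and> length es = n \<and>
        ordered_spectrum (adjacency_mat vs E) es \<and>
        es ! 0 = real d \<and> - real d \<le> es ! (n - 1) \<and>
        (\<forall>i\<in>{1..<n}. \<bar>es ! i\<bar> \<le> lam))"

definition clique_count :: "'a set set \<Rightarrow> nat \<Rightarrow> 'a set \<Rightarrow> nat" where
  "clique_count E i B = card {K. K \<subseteq> B \<and> card K = i \<and> clique K E}"

definition edges_within :: "'a set set \<Rightarrow> 'a set \<Rightarrow> nat" where
  "edges_within E B = card {e \<in> E. e \<subseteq> B}"

text \<open>For \<open>d = 0\<close> the quotient \<open>lam / d\<close> is \<open>0\<close>; only \<open>d > 0\<close> is meaningful.\<close>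

definition theta :: "nat \<Rightarrow> nat \<Rightarrow> real \<Rightarrow> 'a set \<Rightarrow> real" where
  "theta n d lam B = real (card B) / real n + lam / real d"

end

(* Orthogonally diagonalising the adjacency matrix A gives the expander mixing bound
   x . A x <= d (x . 1)^2 / n + lam (x . x); for the indicator vector x of B its left side is
   the sum over v in B of |N(v) \<inter> B|, so this sum is at most m d theta_B. For larger cliques,
   i + 1 times the number of (i+1)-cliques in B is the sum over v in B of the number of
   i-cliques in N(v) \<inter> B; one bounds these by induction, as theta is monotone in the set. *)

theory Submission
  imports Defs "Jordan_Normal_Form.Schur_Decomposition"
begin

section \<open>Orthogonal diagonalisation of real symmetric matrices\<close>

text \<open>Complete \<open>v\<close> to a basis, orthogonalise by Gram-Schmidt, which leaves the
  first vector alone, and normalise. The scalar \<open>c\<close> is the normalising factor of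
  \<open>v\<close>. The result is the change of basis that splits off one eigenvector at a
  time.\<close>

lemma orthogonal_mat_extension:
  fixes v :: "real vec"
  assumes v: "v \<in> carrier_vec n" and v0: "v \<noteq> 0\<^sub>v n" and n: "n \<noteq> 0"
  obtains W c where "W \<in> carrier_mat n n" "transpose_mat W * W = 1\<^sub>m n" "col W 0 = c \<cdot>\<^sub>v v"
proof -
  interpret cof_vec_space n "TYPE(real)" .
  define ws where "ws = gram_schmidt n (basis_completion v)"
  note bc = basis_completion[OF v v0]
  obtain bs where bs: "basis_completion v = v # bs"
    using bc(6,7) n by (cases "basis_completion v") auto
  have ws: "set ws \<subseteq> carrier_vec n" "corthogonal ws" "length ws = n"
    using gram_schmidt_result[OF bc(2,4,5) refl, folded ws_def] bc(6) by auto
  have "hd ws = v"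
    using gram_schmidt_hd[OF v, of bs] by (simp add: ws_def bs)
  then have ws0: "ws ! 0 = v"
    using ws(3) n by (metis hd_conv_nth length_0_conv)
  define k where "k w = 1 / sqrt (w \<bullet> w)" for w :: "real vec"
  define us where "us = map (\<lambda>w. k w \<cdot>\<^sub>v w) ws"
  define W where "W = mat_of_cols n us"
  have len: "length us = n" using ws by (simp add: us_def)
  have wsc: "ws ! i \<in> carrier_vec n" if "i < n" for i using ws that by auto
  have W: "W \<in> carrier_mat n n" unfolding W_def using len by (metis mat_of_cols_carrier(1))
  have col: "col W i = k (ws ! i) \<cdot>\<^sub>v ws ! i" if "i < n" for i
    unfolding W_def using that len wsc ws(3) by (subst col_mat_of_cols) (auto simp: us_def)
  have "transpose_mat W * W = 1\<^sub>m n"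
  proof (rule eq_matI)
    fix i j assume "i < dim_row (1\<^sub>m n :: real mat)" "j < dim_col (1\<^sub>m n :: real mat)"
    then have ij: "i < n" "j < n" by auto
    have *: "(transpose_mat W * W) $$ (i, j) = k (ws ! i) * (k (ws ! j) * (ws ! i \<bullet> ws ! j))"
      using W ij by (simp add: col smult_scalar_prod_distrib[OF wsc wsc]
          smult_scalar_prod_distrib[OF wsc iffD2[OF smult_carrier_vec wsc]]
          scalar_prod_smult_distrib[OF wsc wsc])
    \<comment> \<open>\<open>corthogonal\<close> also says that no vector is zero, so that dividing
      by the norm is legitimate. Over the reals its conjugation is trivial.\<close>
    have orth: "(ws ! i \<bullet> ws ! j = 0) = (i \<noteq> j)"
      using corthogonalD[OF ws(2), of i j] ij ws(3) by simp
    show "(transpose_mat W * W) $$ (i, j) = 1\<^sub>m n $$ (i, j)"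
    proof (cases "i = j")
      case True
      have "ws ! i \<bullet> ws ! i \<noteq> 0" using orth True by simp
      moreover have "ws ! i \<bullet> ws ! i \<ge> 0" by (simp add: scalar_prod_def sum_nonneg)
      ultimately have "k (ws ! i) * (k (ws ! i) * (ws ! i \<bullet> ws ! i)) = 1"
        by (simp add: k_def)
      then show ?thesis using * True ij by simp
    qed (use * orth ij in auto)
  qed (use W in auto)
  with W col[of 0] ws0 n show thesis by (intro that) auto
qed

text \<open>Deflation, by induction on the list of roots: in an orthonormal basis that starts with
  an eigenvector for the head \<open>e\<close>, symmetry makes the matrix block diagonal with blocks
  \<open>e\<close> and \<open>A3\<close>, and the induction hypothesis diagonalises
  \<open>A3\<close>. The order of \<open>es\<close> is kept, so column \<open>i\<close> of
  \<open>P\<close> belongs to \<open>es ! i\<close>.\<close>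

lemma real_symmetric_orthogonal_diagonalization:
  fixes A :: "real mat"
  assumes "A \<in> carrier_mat n n" "transpose_mat A = A" "char_poly A = (\<Prod>e\<leftarrow>es. [:- e, 1:])"
  shows "\<exists>P \<in> carrier_mat n n. transpose_mat P * P = 1\<^sub>m n \<and> A * P = P * mat_diag n ((!) es)"
  using assms
proof (induction es arbitrary: n A)
  case Nil
  \<comment> \<open>The empty product has degree 0, while the characteristic polynomial has degree
    \<open>n\<close>.\<close>
  then have "n = 0" using degree_monic_char_poly[of A n] by simp
  then show ?case using Nil by (intro bexI[of _ "1\<^sub>m n"]) (auto intro!: eq_matI simp: mat_diag_def)
next
  case (Cons e es)
  note A = Cons.prems(1) and sym = Cons.prems(2)
  have cp: "char_poly A = [:- e, 1:] * (\<Prod>e\<leftarrow>es. [:- e, 1:])" using Cons.prems(3) by simp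
  have ev: "eigenvalue A e"
    unfolding eigenvalue_root_char_poly[OF A] cp by simp
  then obtain v where v: "v \<in> carrier_vec n" "v \<noteq> 0\<^sub>v n" "A *\<^sub>v v = e \<cdot>\<^sub>v v"
    unfolding eigenvalue_def eigenvector_def using A by auto
  obtain n1 where n: "n = Suc n1"
    using eigenvalue_imp_nonzero_dim[OF A ev] by (cases n) auto
  obtain W c where W: "W \<in> carrier_mat n n" and WW: "transpose_mat W * W = 1\<^sub>m n"
    and W0: "col W 0 = c \<cdot>\<^sub>v v"
    using orthogonal_mat_extension[OF v(1,2)] n by blast
  let ?WT = "transpose_mat W"
  have WT: "?WT \<in> carrier_mat n n" using W by simp
  have WW': "W * ?WT = 1\<^sub>m n" using mat_mult_left_right_inverse[OF WT W WW] .
  define A' where "A' = ?WT * (A * W)"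
  have A': "A' \<in> carrier_mat n n" using A W by (simp add: A'_def)
  have WA': "W * A' = A * W"
  proof -
    have "W * A' = (W * ?WT) * (A * W)"
      unfolding A'_def using A W WT by (subst assoc_mult_mat) auto
    then show ?thesis using A W WW' by simp
  qed
  have symA': "transpose_mat A' = A'"
  proof -
    have "transpose_mat A' = transpose_mat (A * W) * transpose_mat ?WT"
      unfolding A'_def using A W WT by (subst transpose_mult) auto
    also have "\<dots> = (?WT * A) * W"
      using A W sym by (subst transpose_mult[OF A W]) simp
    also have "\<dots> = A'"
      unfolding A'_def using A W WT by (subst assoc_mult_mat) auto
    finally show ?thesis .
  qed
  \<comment> \<open>Similarity is what carries the characteristic polynomial over to
    \<open>A'\<close>.\<close>
  have sim: "similar_mat A A'"
  proof -
    have "A = A * (W * ?WT)" using A WW' by simp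
    also have "\<dots> = A * W * ?WT" using A W WT by (subst assoc_mult_mat) auto
    finally have "A = W * A' * ?WT" using WA' by simp
    then show ?thesis
      unfolding similar_mat_def
      using similar_mat_witI[OF WW' WW _ A A' W WT] by blast
  qed
  have Aw: "A *\<^sub>v col W 0 = e \<cdot>\<^sub>v col W 0"
  proof -
    have "A *\<^sub>v col W 0 = c \<cdot>\<^sub>v (e \<cdot>\<^sub>v v)"
      unfolding W0 v(3)[symmetric] using A v by (intro mult_mat_vec) auto
    then show ?thesis unfolding W0 by (simp add: smult_smult_assoc mult.commute)
  qed
  \<comment> \<open>The first column of \<open>W\<close> is an eigenvector, so the first column of
    \<open>A'\<close> is \<open>e\<close> times the first column of \<open>?WT * W\<close>, which is
    the identity.\<close>
  have col0: "A' $$ (i, 0) = (if i = 0 then e else 0)" if "i < n" for i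
  proof -
    have "A' $$ (i, 0) = row ?WT i \<bullet> (A *\<^sub>v col W 0)"
    proof -
      have "A' $$ (i, 0) = row ?WT i \<bullet> col (A * W) 0"
        unfolding A'_def using A W that n by (intro index_mult_mat(1)) auto
      then show ?thesis using n by (simp only: col_mult2[OF A W])
    qed
    also have "\<dots> = e * (?WT * W) $$ (i, 0)"
      unfolding Aw using W that n by simp
    also have "\<dots> = (if i = 0 then e else 0)"
      unfolding WW using that n by simp
    finally show ?thesis .
  qed
  \<comment> \<open>Symmetry reflects the zeros of the first column into the first row; this is
    where block triangular becomes block diagonal.\<close>
  have row0: "A' $$ (0, i) = (if i = 0 then e else 0)" if "i < n" for i
    using col0[OF that] arg_cong[OF symA', of "\<lambda>M. M $$ (i, 0)"] A' that n by simp
  define A3 where "A3 = mat n1 n1 (\<lambda>(i, j). A' $$ (Suc i, Suc j))"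
  have A3: "A3 \<in> carrier_mat n1 n1" by (simp add: A3_def)
  define E1 where "E1 = mat 1 1 (\<lambda>_. e)"
  have E1: "E1 \<in> carrier_mat 1 1" by (simp add: E1_def)
  have blk: "A' = four_block_mat E1 (0\<^sub>m 1 n1) (0\<^sub>m n1 1) A3"
    using A' n col0 row0 by (intro eq_matI) (auto simp: A3_def E1_def)
  have "transpose_mat A3 = A3"
  proof (rule eq_matI)
    fix i j assume "i < dim_row A3" "j < dim_col A3"
    then show "transpose_mat A3 $$ (i, j) = A3 $$ (i, j)"
      using arg_cong[OF symA', of "\<lambda>M. M $$ (Suc i, Suc j)"] A' n by (simp add: A3_def)
  qed (use A3 in auto)
  moreover have "char_poly A3 = (\<Prod>e\<leftarrow>es. [:- e, 1:])"
  proof -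
    have "char_poly A = char_poly E1 * char_poly A3"
      unfolding char_poly_similar[OF sim] blk
      by (rule char_poly_four_block_zeros_col[OF E1 zero_carrier_mat A3])
    moreover have "char_poly E1 = [:- e, 1:]"
      by (simp add: E1_def char_poly_defs det_def sign_def)
    ultimately have "[:- e, 1:] * char_poly A3 = [:- e, 1:] * (\<Prod>e\<leftarrow>es. [:- e, 1:])"
      using cp by simp
    \<comment> \<open>Cancelling the linear factor of \<open>e\<close> leaves the product over the
      tail, as the induction hypothesis requires.\<close>
    then show ?thesis by (metis mult_cancel_left pCons_eq_0_iff zero_neq_one)
  qed
  ultimately obtain P3 where P3: "P3 \<in> carrier_mat n1 n1"
    and PP3: "transpose_mat P3 * P3 = 1\<^sub>m n1" and AP3: "A3 * P3 = P3 * mat_diag n1 ((!) es)"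
    using Cons.IH[OF A3] by blast
  \<comment> \<open>\<open>F\<close> fixes the split-off eigenvector and diagonalises its orthogonal
    complement; \<open>W * F\<close> is the required matrix.\<close>
  define F where "F = four_block_mat (1\<^sub>m 1) (0\<^sub>m 1 n1) (0\<^sub>m n1 1) P3"
  let ?D = "mat_diag n ((!) (e # es))"
  have F: "F \<in> carrier_mat n n"
    using four_block_carrier_mat[OF one_carrier_mat[of 1] P3] n by (simp add: F_def)
  have D: "?D \<in> carrier_mat n n" by simp
  have D_blk: "?D = four_block_mat E1 (0\<^sub>m 1 n1) (0\<^sub>m n1 1) (mat_diag n1 ((!) es))"
    using n by (intro eq_matI) (auto simp: mat_diag_def E1_def)
  have FF: "transpose_mat F * F = 1\<^sub>m n"
  proof -
    have "transpose_mat F = four_block_mat (1\<^sub>m 1) (0\<^sub>m 1 n1) (0\<^sub>m n1 1) (transpose_mat P3)"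
      unfolding F_def using P3 by (subst transpose_four_block_mat) auto
    moreover have "four_block_mat (1\<^sub>m 1) (0\<^sub>m 1 n1) (0\<^sub>m n1 1) (transpose_mat P3) *
        four_block_mat (1\<^sub>m 1) (0\<^sub>m 1 n1) (0\<^sub>m n1 1) P3
      = four_block_mat (1\<^sub>m 1) (0\<^sub>m 1 n1) (0\<^sub>m n1 1) (1\<^sub>m n1)"
      using P3 PP3 by (subst mult_four_block_mat[where ?n1.0 = 1 and ?n2.0 = n1]) auto
    ultimately show ?thesis
      unfolding F_def n using four_block_one_mat[of 1 n1] by simp
  qed
  have A'F: "A' * F = F * ?D"
  proof -
    have "A' * F = four_block_mat E1 (0\<^sub>m 1 n1) (0\<^sub>m n1 1) (A3 * P3)"
      unfolding blk F_def using P3 A3 E1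
      by (subst mult_four_block_mat[where ?n1.0 = 1 and ?n2.0 = n1]) auto
    moreover have "F * ?D = four_block_mat E1 (0\<^sub>m 1 n1) (0\<^sub>m n1 1) (P3 * mat_diag n1 ((!) es))"
      unfolding D_blk F_def using P3 E1
      by (subst mult_four_block_mat[where ?n1.0 = 1 and ?n2.0 = n1])
        (auto simp: left_mult_zero_mat[OF mat_diag_dim])
    ultimately show ?thesis using AP3 by simp
  qed
  show ?case
  proof (intro bexI[of _ "W * F"] conjI)
    show "W * F \<in> carrier_mat n n" using W F by simp
    have FT: "transpose_mat F \<in> carrier_mat n n" using F by simp
    have "transpose_mat (W * F) * (W * F) = transpose_mat F * (?WT * (W * F))"
      unfolding transpose_mult[OF W F] using W F FT WT by (subst assoc_mult_mat) auto
    also have "?WT * (W * F) = ?WT * W * F" using W F WT by (subst assoc_mult_mat) auto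
    finally show "transpose_mat (W * F) * (W * F) = 1\<^sub>m n" using WW FF F by simp
    have "A * (W * F) = A * W * F" using A W F by (subst assoc_mult_mat) auto
    also have "\<dots> = W * (A' * F)" unfolding WA'[symmetric] using A' W F by (subst assoc_mult_mat) auto
    also have "\<dots> = W * F * ?D" unfolding A'F by (rule assoc_mult_mat[OF W F D, symmetric])
    finally show "A * (W * F) = W * F * ?D" .
  qed
qed

section \<open>Spectral bound on a quadratic form\<close>

text \<open>In the eigenbasis the form is a weighted sum of squares. The direction of
  \<open>u\<close> yields the first term, and all other weights are at most \<open>lam\<close>.
  Since \<open>u\<close> is any eigenvector for \<open>es ! 0\<close> and not a chosen column of
  \<open>P\<close>, the proof depends on whether that eigenvalue is repeated.\<close>

lemma quadratic_form_le:
  fixes A :: "real mat"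
  assumes A: "A \<in> carrier_mat n n" "transpose_mat A = A"
    and spec: "ordered_spectrum A es" "length es = n"
    and u: "u \<in> carrier_vec n" "u \<noteq> 0\<^sub>v n" "A *\<^sub>v u = es ! 0 \<cdot>\<^sub>v u"
    and es0: "0 \<le> es ! 0"
    and lam: "0 \<le> lam" "\<And>i. i \<in> {1..<n} \<Longrightarrow> es ! i \<le> lam"
    and x: "x \<in> carrier_vec n"
  shows "x \<bullet> (A *\<^sub>v x) \<le> es ! 0 * ((x \<bullet> u)\<^sup>2 / (u \<bullet> u)) + lam * (x \<bullet> x)"
proof -
  let ?d = "es ! 0"
  obtain P where P: "P \<in> carrier_mat n n" and PP: "transpose_mat P * P = 1\<^sub>m n"
    and AP: "A * P = P * mat_diag n ((!) es)"
    using real_symmetric_orthogonal_diagonalization[OF A] spec(1)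
    unfolding ordered_spectrum_def by blast
  let ?PT = "transpose_mat P" and ?D = "mat_diag n ((!) es)"
  have PT: "?PT \<in> carrier_mat n n" using P by simp
  have D: "?D \<in> carrier_mat n n" by simp
  have PP': "P * ?PT = 1\<^sub>m n" using mat_mult_left_right_inverse[OF PT P PP] .
  define y where "y = ?PT *\<^sub>v x"
  define z where "z = ?PT *\<^sub>v u"
  have y: "y \<in> carrier_vec n" and z: "z \<in> carrier_vec n" using PT x u by (auto simp: y_def z_def)
  have Py: "P *\<^sub>v y = x" and Pz: "P *\<^sub>v z = u"
    using assoc_mult_mat_vec[OF P PT x] assoc_mult_mat_vec[OF P PT u(1)] PP' x u
    by (auto simp: y_def z_def)
  have iso: "(P *\<^sub>v a) \<bullet> (P *\<^sub>v b) = a \<bullet> b"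
    if a: "a \<in> carrier_vec n" and b: "b \<in> carrier_vec n" for a b
  proof -
    have "(P *\<^sub>v b) \<bullet> (P *\<^sub>v a) = (?PT *\<^sub>v (P *\<^sub>v b)) \<bullet> a"
      using P a b by (subst transpose_vec_mult_scalar[OF P]) auto
    also have "\<dots> = b \<bullet> a"
      using assoc_mult_mat_vec[OF PT P b] PP b by simp
    finally show ?thesis
      using a b P by (metis comm_scalar_prod mult_mat_vec_carrier)
  qed
  have Dv: "?D *\<^sub>v a = vec n (\<lambda>i. es ! i * a $ i)" if "a \<in> carrier_vec n" for a
    using that by (intro eq_vecI)
      (auto simp: mat_diag_def scalar_prod_def if_distrib[of "\<lambda>t. t * _"] sum.delta cong: if_cong)
  have APv: "A *\<^sub>v (P *\<^sub>v a) = P *\<^sub>v (?D *\<^sub>v a)" if "a \<in> carrier_vec n" for a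
    using assoc_mult_mat_vec[OF A(1) P that] assoc_mult_mat_vec[OF P D that] AP by simp
  have xAx: "x \<bullet> (A *\<^sub>v x) = (\<Sum>i<n. es ! i * (y $ i)\<^sup>2)"
  proof -
    have "x \<bullet> (A *\<^sub>v x) = (P *\<^sub>v y) \<bullet> (P *\<^sub>v (?D *\<^sub>v y))"
      using APv[OF y] Py by simp
    also have "\<dots> = y \<bullet> (?D *\<^sub>v y)" using y mult_mat_vec_carrier[OF D y] by (intro iso)
    finally show ?thesis
      by (simp add: Dv[OF y] scalar_prod_def power2_eq_square lessThan_atLeast0 mult_ac)
  qed
  have xx: "x \<bullet> x = (\<Sum>i<n. (y $ i)\<^sup>2)"
    using iso[OF y y] y by (simp add: Py scalar_prod_def power2_eq_square lessThan_atLeast0)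
  have xu: "x \<bullet> u = (\<Sum>i<n. y $ i * z $ i)"
    using iso[OF y z] z by (simp add: Py Pz scalar_prod_def lessThan_atLeast0)
  have uu: "u \<bullet> u = (\<Sum>i<n. (z $ i)\<^sup>2)"
    using iso[OF z z] z by (simp add: Pz scalar_prod_def power2_eq_square lessThan_atLeast0)
  have "?PT *\<^sub>v (A *\<^sub>v u) = ?D *\<^sub>v z"
    using assoc_mult_mat_vec[OF PT P, of "?D *\<^sub>v z"] APv[OF z] PP D z
    by (simp add: Pz)
  moreover have "?PT *\<^sub>v (A *\<^sub>v u) = ?d \<cdot>\<^sub>v z"
    unfolding u(3) z_def using PT u(1) by (intro mult_mat_vec)
  ultimately have Dz: "?D *\<^sub>v z = ?d \<cdot>\<^sub>v z" by simp
  \<comment> \<open>Hence \<open>z\<close>, the coordinate vector of \<open>u\<close>, is supported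
    on the positions whose eigenvalue equals \<open>?d\<close>.\<close>
  have ez: "es ! i * z $ i = ?d * z $ i" if "i < n" for i
    using arg_cong[OF Dz, of "\<lambda>w. w $ i"] that z by (simp add: Dv[OF z])
  have n0: "0 < n" using u(1,2) by (cases n) auto
  have ysum: "(\<Sum>i<n. f i) = f 0 + (\<Sum>i\<in>{1..<n}. f i)" for f :: "nat \<Rightarrow> real"
    using n0 by (simp add: lessThan_atLeast0 sum.atLeast_Suc_lessThan)
  show ?thesis
  proof (cases "\<exists>i\<in>{1..<n}. es ! i = ?d")
    \<comment> \<open>With a repeated top eigenvalue \<open>u\<close> may spread over several
      coordinates, but then \<open>?d \<le> lam\<close>. All eigenvalues are at most
      \<open>lam\<close>, and the first term only has to be non-negative.\<close>
    case True
    have "es ! i \<le> ?d" if "i < n" for i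
      using spec that unfolding ordered_spectrum_def
      by (cases "i = 0") (auto simp: sorted_wrt_iff_nth_less)
    moreover have "?d \<le> lam" using True lam(2) by force
    ultimately have "x \<bullet> (A *\<^sub>v x) \<le> lam * (x \<bullet> x)"
      unfolding xAx xx sum_distrib_left by (intro sum_mono mult_right_mono) force+
    moreover have "0 \<le> ?d * ((x \<bullet> u)\<^sup>2 / (u \<bullet> u))"
      using es0 unfolding uu by (intro mult_nonneg_nonneg divide_nonneg_nonneg sum_nonneg) auto
    ultimately show ?thesis by linarith
  next
    case False
    \<comment> \<open>With a simple top eigenvalue \<open>u\<close> lies along the first column of
      \<open>P\<close>, so the squared projection of \<open>x\<close> onto \<open>u\<close> is
      exactly the square of \<open>y $ 0\<close>.\<close>
    have z0: "z $ i = 0" if "i \<in> {1..<n}" for i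
      using ez[of i] False that by auto
    have "z $ 0 \<noteq> 0"
    proof
      assume "z $ 0 = 0"
      then have "z $ i = 0" if "i < n" for i using z0[of i] that by (cases "i = 0") auto
      then have "z = 0\<^sub>v n" using z by (intro eq_vecI) auto
      then show False using Pz u(2) P by auto
    qed
    moreover have "x \<bullet> u = y $ 0 * z $ 0" "u \<bullet> u = (z $ 0)\<^sup>2"
      unfolding xu uu ysum using z0 by simp_all
    ultimately have c: "(x \<bullet> u)\<^sup>2 / (u \<bullet> u) = (y $ 0)\<^sup>2"
      by (simp add: power_mult_distrib)
    have "(\<Sum>i\<in>{1..<n}. es ! i * (y $ i)\<^sup>2) \<le> lam * (\<Sum>i\<in>{1..<n}. (y $ i)\<^sup>2)"
      unfolding sum_distrib_left using lam(2) by (intro sum_mono mult_right_mono) auto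
    also have "\<dots> \<le> lam * (x \<bullet> x)"
      unfolding xx ysum using lam(1) by (intro mult_left_mono) auto
    finally show ?thesis unfolding xAx ysum c by simp
  qed
qed

section \<open>Counting neighbours and cliques\<close>

text \<open>Degrees are defined by incident edges, whereas rows of the adjacency matrix count
  neighbours; sending \<open>w\<close> to \<open>{v, w}\<close> matches the two.\<close>

lemma card_neighbours:
  assumes "simple_graph V E"
  shows "card {w \<in> V. {v, w} \<in> E} = degree_in E v"
proof -
  have E: "e \<subseteq> V \<and> card e = 2" if "e \<in> E" for e
    using assms that by (auto simp: simple_graph_def nsets_def)
  have "e \<in> (\<lambda>w. {v, w}) ` {w \<in> V. {v, w} \<in> E}" if e: "e \<in> E" "v \<in> e" for e
  proof -
    have "card (e - {v}) = 1" using E[OF e(1)] e(2) by simp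
    then obtain w where w: "e - {v} = {w}" by (rule card_1_singletonE)
    then have "e = {v, w}" using e(2) by blast
    moreover have "w \<in> V" using w E[OF e(1)] by blast
    ultimately show ?thesis using e(1) by blast
  qed
  then have "{e \<in> E. v \<in> e} = (\<lambda>w. {v, w}) ` {w \<in> V. {v, w} \<in> E}" by blast
  moreover have "inj_on (\<lambda>w. {v, w}) {w \<in> V. {v, w} \<in> E}"
    by (auto intro!: inj_onI simp: doubleton_eq_iff)
  ultimately show ?thesis by (simp add: degree_in_def card_image)
qed

text \<open>Both sides count the pairs of a clique of size \<open>Suc i\<close> and one of its vertices.\<close>

lemma clique_count_Suc:
  assumes B: "finite B" and irrefl: "\<And>v. {v} \<notin> E"
  shows "Suc i * clique_count E (Suc i) B = (\<Sum>v\<in>B. clique_count E i {w \<in> B. {v, w} \<in> E})"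
proof -
  define C where "C = {K. K \<subseteq> B \<and> card K = Suc i \<and> clique K E}"
  have finC: "finite C" using B by (auto simp: C_def)
  have "card {K \<in> C. v \<in> K} = clique_count E i {w \<in> B. {v, w} \<in> E}" if "v \<in> B" for v
  proof -
    let ?N = "{w \<in> B. {v, w} \<in> E}"
    \<comment> \<open>Deleting \<open>v\<close> and inserting it are mutually inverse. As there are
      no loops, \<open>v\<close> is not its own neighbour, so insertion does raise the size by
      one.\<close>
    have "bij_betw (\<lambda>K. K - {v}) {K \<in> C. v \<in> K} {K. K \<subseteq> ?N \<and> card K = i \<and> clique K E}"
    proof (rule bij_betwI[where g = "insert v"])
      show "(\<lambda>K. K - {v}) \<in> {K \<in> C. v \<in> K} \<rightarrow> {K. K \<subseteq> ?N \<and> card K = i \<and> clique K E}"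
        by (auto simp: C_def clique_def)
      show "insert v \<in> {K. K \<subseteq> ?N \<and> card K = i \<and> clique K E} \<rightarrow> {K \<in> C. v \<in> K}"
      proof
        fix K assume "K \<in> {K. K \<subseteq> ?N \<and> card K = i \<and> clique K E}"
        then have K: "K \<subseteq> ?N" "card K = i" "clique K E" by auto
        have "v \<notin> K" using K(1) irrefl[of v] by auto
        moreover have "finite K" using K(1) B by (auto intro: finite_subset[OF _ B])
        moreover have "clique (insert v K) E"
        proof -
          have "{v, w} \<in> E \<and> {w, v} \<in> E" if "w \<in> K" for w
            using K(1) that by (auto simp: insert_commute[of w v])
          then show ?thesis using K(3) by (simp add: clique_def)
        qed
        ultimately show "insert v K \<in> {K \<in> C. v \<in> K}"
          using K that by (auto simp: C_def)
      qed
    qed (use irrefl[of v] in auto)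
    then show ?thesis unfolding clique_count_def by (rule bij_betw_same_card)
  qed
  then have "(\<Sum>v\<in>B. clique_count E i {w \<in> B. {v, w} \<in> E}) = (\<Sum>v\<in>B. card {K \<in> C. v \<in> K})"
    by simp
  also have "\<dots> = (\<Sum>K\<in>C. card {v \<in> B. v \<in> K})"
    using sum_multicount_gen[OF B finC, of "\<lambda>v K. v \<in> K" "\<lambda>K. card {v \<in> B. v \<in> K}"] by simp
  also have "\<dots> = (\<Sum>K\<in>C. Suc i)"
  proof (rule sum.cong)
    fix K assume "K \<in> C"
    then have "{v \<in> B. v \<in> K} = K" "card K = Suc i" by (auto simp: C_def)
    then show "card {v \<in> B. v \<in> K} = Suc i" by simp
  qed simp
  finally show ?thesis by (simp add: clique_count_def C_def)
qed

lemma clique_count_1: "finite B \<Longrightarrow> clique_count E 1 B = card B"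
proof -
  have "{K. K \<subseteq> B \<and> card K = 1 \<and> clique K E} = (\<lambda>v. {v}) ` B"
    by (auto simp: card_1_singleton_iff clique_def)
  then show ?thesis by (simp add: clique_count_def card_image)
qed

lemma clique_count_2:
  assumes "simple_graph V E"
  shows "clique_count E 2 B = edges_within E B"
proof -
  have E: "card e = 2" if "e \<in> E" for e using assms that by (auto simp: simple_graph_def nsets_def)
  have "card K = 2 \<and> clique K E \<longleftrightarrow> K \<in> E" for K
  proof
    assume "card K = 2 \<and> clique K E"
    then show "K \<in> E" by (auto simp: card_2_iff clique_def)
  next
    assume K: "K \<in> E"
    then obtain a b where "K = {a, b}" using E[OF K] by (auto simp: card_2_iff)
    with K E[OF K] show "card K = 2 \<and> clique K E"
      using insert_commute[of a b "{}"] by (auto simp: clique_def)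
  qed
  then have "{K. K \<subseteq> B \<and> card K = 2 \<and> clique K E} = {e \<in> E. e \<subseteq> B}" by blast
  then show ?thesis by (simp add: clique_count_def edges_within_def)
qed

text \<open>Pure counting: the spectrum enters only through \<open>mix\<close>. In the application
  \<open>d\<close> stands for the degree divided by \<open>n\<close> and \<open>l\<close> for
  \<open>lam\<close>, so \<open>d * card B + l\<close> is the degree times theta. The induction is
  over all subsets of \<open>V\<close> at once, because it passes from \<open>B\<close> to the
  neighbourhoods inside \<open>B\<close>.\<close>

lemma clique_count_le:
  fixes d l :: real
  assumes "finite V" and irrefl: "\<And>v. {v} \<notin> E" and "0 \<le> d" "0 \<le> l"
    and mix: "\<And>B. B \<subseteq> V \<Longrightarrow> real (\<Sum>v\<in>B. card {w \<in> B. {v, w} \<in> E}) \<le> card B * (d * card B + l)"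
    and "B \<subseteq> V"
  shows "real (clique_count E (Suc k) B) \<le> card B / fact (Suc k) * (d * card B + l) ^ k"
  using \<open>B \<subseteq> V\<close>
proof (induction k arbitrary: B)
  case 0
  then show ?case using clique_count_1[of B E] finite_subset[OF 0 \<open>finite V\<close>] by simp
next
  case (Suc k)
  have B: "finite B" using Suc.prems \<open>finite V\<close> by (rule finite_subset)
  let ?N = "\<lambda>v. {w \<in> B. {v, w} \<in> E}" and ?t = "d * card B + l"
  have t: "0 \<le> ?t" using \<open>0 \<le> d\<close> \<open>0 \<le> l\<close> by simp
  have "real (Suc (Suc k)) * clique_count E (Suc (Suc k)) B
    = (\<Sum>v\<in>B. real (clique_count E (Suc k) (?N v)))"
    using clique_count_Suc[OF B irrefl, of "Suc k"] by (simp only: of_nat_mult[symmetric] of_nat_sum)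
  also have "\<dots> \<le> (\<Sum>v\<in>B. card (?N v) / fact (Suc k) * ?t ^ k)"
  proof (rule sum_mono)
    fix v
    have "real (clique_count E (Suc k) (?N v)) \<le> card (?N v) / fact (Suc k) * (d * card (?N v) + l) ^ k"
      using Suc.prems by (intro Suc.IH) auto
    \<comment> \<open>Only the power is weakened from the neighbourhood to \<open>B\<close>. The
      linear factor \<open>card (?N v)\<close> stays, since its sum over \<open>B\<close> is what
      \<open>mix\<close> controls.\<close>
    also have "\<dots> \<le> card (?N v) / fact (Suc k) * ?t ^ k"
    proof -
      have "card (?N v) \<le> card B" using B by (intro card_mono) auto
      then show ?thesis
        using \<open>0 \<le> d\<close> \<open>0 \<le> l\<close> by (intro mult_left_mono power_mono add_right_mono) auto
    qed
    finally show "real (clique_count E (Suc k) (?N v)) \<le> card (?N v) / fact (Suc k) * ?t ^ k" .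
  qed
  also have "\<dots> = real (\<Sum>v\<in>B. card (?N v)) / fact (Suc k) * ?t ^ k"
    by (simp only: of_nat_sum sum_divide_distrib sum_distrib_right)
  also have "\<dots> \<le> card B * ?t / fact (Suc k) * ?t ^ k"
    using t by (intro mult_right_mono divide_right_mono mix[OF Suc.prems]) auto
  finally have "clique_count E (Suc (Suc k)) B \<le> card B * ?t / fact (Suc k) * ?t ^ k / real (Suc (Suc k))"
    by (subst pos_le_divide_eq) (simp_all add: mult.commute)
  also have "\<dots> = card B / fact (Suc (Suc k)) * ?t ^ Suc k"
    unfolding fact_Suc[of "Suc k"] by (simp add: mult_ac)
  finally show ?case .
qed

section \<open>The mixing bound for (n, d, lam)-graphs\<close>

text \<open>This is the quadratic form bound for the indicator vector \<open>x\<close> of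
  \<open>B\<close> and the all-ones vector \<open>u\<close>, where \<open>x \<bullet> u\<close> and
  \<open>x \<bullet> x\<close> are both \<open>card B\<close> and \<open>u \<bullet> u\<close> is
  \<open>n\<close>. The left side counts ordered pairs, so every edge inside \<open>B\<close> counts
  twice.\<close>

lemma expander_mixing:
  assumes G: "ndl_graph V E n d lam" and "0 \<le> lam" and B: "B \<subseteq> V"
  shows "real (\<Sum>v\<in>B. card {w \<in> B. {v, w} \<in> E}) \<le> card B * (real d / n * card B + lam)"
proof -
  from G have simple: "simple_graph V E" and cardV: "card V = n" and n: "0 < n"
    and reg: "regular_graph V E d"
    unfolding ndl_graph_def by auto
  obtain vs es where vs: "distinct vs" "set vs = V" and es: "length es = n"
    and spec: "ordered_spectrum (adjacency_mat vs E) es" and es0: "es ! 0 = real d"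
    and lam: "\<And>i. i \<in> {1..<n} \<Longrightarrow> \<bar>es ! i\<bar> \<le> lam"
    using G unfolding ndl_graph_def by blast
  have len: "length vs = n" using distinct_card[OF vs(1)] vs(2) cardV by simp
  have finV: "finite V" using vs(2) by auto
  have nth: "vs ! i \<in> V" if "i < n" for i using that len vs(2) by auto
  have sum_vs: "(\<Sum>i = 0..<n. f (vs ! i)) = sum f V" for f :: "'a \<Rightarrow> real"
    using sum.reindex_bij_betw[OF bij_betw_nth[OF vs(1), of "{0..<n}" V]] len vs(2)
    by (simp add: lessThan_atLeast0)
  have card_sum: "(\<Sum>v\<in>V. of_bool (P v)) = real (card {v \<in> V. P v})" for P
    using finV by (simp add: sum_of_bool_eq Int_def)
  define A where "A = adjacency_mat vs E"
  define u :: "real vec" where "u = vec n (\<lambda>_. 1)"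
  define x :: "real vec" where "x = vec n (\<lambda>i. of_bool (vs ! i \<in> B))"
  have A: "A \<in> carrier_mat n n" by (simp add: A_def adjacency_mat_def len)
  have Aij: "A $$ (i, j) = of_bool ({vs ! i, vs ! j} \<in> E)" if "i < n" "j < n" for i j
    using that by (simp add: A_def adjacency_mat_def len)
  have sym: "transpose_mat A = A"
    using A by (intro eq_matI) (auto simp: Aij insert_commute)
  have u: "u \<in> carrier_vec n" and x: "x \<in> carrier_vec n" by (simp_all add: u_def x_def)
  have "u $ 0 \<noteq> 0\<^sub>v n $ 0" using n by (simp add: u_def)
  then have u0: "u \<noteq> 0\<^sub>v n" by auto
  \<comment> \<open>Stated for a predicate so as to serve both vectors: \<open>P\<close> is
    constantly true for \<open>u\<close> and membership in \<open>B\<close> for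
    \<open>x\<close>.\<close>
  have A_mult: "(A *\<^sub>v vec n (\<lambda>j. of_bool (P (vs ! j)))) $ i = card {w \<in> V. P w \<and> {vs ! i, w} \<in> E}"
    if i: "i < n" for P i
  proof -
    have "(A *\<^sub>v vec n (\<lambda>j. of_bool (P (vs ! j)))) $ i
      = (\<Sum>j = 0..<n. of_bool (P (vs ! j) \<and> {vs ! i, vs ! j} \<in> E))"
      using A i by (auto simp: scalar_prod_def Aij intro!: arg_cong[where f = card])
    also have "\<dots> = (\<Sum>w\<in>V. of_bool (P w \<and> {vs ! i, w} \<in> E))" by (rule sum_vs)
    finally show ?thesis by (simp only: card_sum)
  qed
  \<comment> \<open>Regularity makes the all-ones vector an eigenvector for the degree.\<close>
  have "A *\<^sub>v u = es ! 0 \<cdot>\<^sub>v u"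
  proof (rule eq_vecI)
    fix i assume "i < dim_vec (es ! 0 \<cdot>\<^sub>v u)"
    then have i: "i < n" by (simp add: u_def)
    have "(A *\<^sub>v u) $ i = card {w \<in> V. {vs ! i, w} \<in> E}"
      using A_mult[OF i, of "\<lambda>_. True"] by (simp add: u_def)
    also have "\<dots> = d"
      using reg nth[OF i] by (simp add: card_neighbours[OF simple] regular_graph_def)
    finally show "(A *\<^sub>v u) $ i = (es ! 0 \<cdot>\<^sub>v u) $ i" using i by (simp add: es0 u_def)
  qed (use A in \<open>simp add: u_def\<close>)
  then have bound: "x \<bullet> (A *\<^sub>v x) \<le> es ! 0 * ((x \<bullet> u)\<^sup>2 / (u \<bullet> u)) + lam * (x \<bullet> x)"
    using A sym spec es u u0 es0 \<open>0 \<le> lam\<close> lam x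
    by (intro quadratic_form_le) (auto simp: A_def abs_le_iff)
  have VB: "{v \<in> V. v \<in> B} = B" using B by auto
  have count: "(\<Sum>i = 0..<n. of_bool (vs ! i \<in> B)) = real (card B)"
    using sum_vs[of "\<lambda>v. of_bool (v \<in> B)"] card_sum[of "\<lambda>v. v \<in> B"] VB by (simp only:)
  have "x \<bullet> u = (\<Sum>i = 0..<n. of_bool (vs ! i \<in> B))"
    by (simp add: scalar_prod_def u_def x_def)
  then have xu: "x \<bullet> u = card B" by (simp only: count)
  have "x \<bullet> x = (\<Sum>i = 0..<n. of_bool (vs ! i \<in> B))"
    by (auto simp: scalar_prod_def x_def intro!: sum.cong)
  then have xx: "x \<bullet> x = card B" by (simp only: count)
  have uu: "u \<bullet> u = n" by (simp add: scalar_prod_def u_def)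
  have Ax: "(A *\<^sub>v x) $ i = card {w \<in> B. {vs ! i, w} \<in> E}" if "i < n" for i
  proof -
    have "{w \<in> V. w \<in> B \<and> {vs ! i, w} \<in> E} = {w \<in> B. {vs ! i, w} \<in> E}" using B by auto
    then show ?thesis using A_mult[OF that, of "\<lambda>w. w \<in> B"] by (simp add: x_def)
  qed
  have "x \<bullet> (A *\<^sub>v x)
    = (\<Sum>i = 0..<n. of_bool (vs ! i \<in> B) * real (card {w \<in> B. {vs ! i, w} \<in> E}))"
  proof -
    have "x \<bullet> (A *\<^sub>v x) = (\<Sum>i = 0..<n. x $ i * (A *\<^sub>v x) $ i)"
      unfolding scalar_prod_def[of x "A *\<^sub>v x"] using A by simp
    also have "\<dots> = (\<Sum>i = 0..<n. of_bool (vs ! i \<in> B) * real (card {w \<in> B. {vs ! i, w} \<in> E}))"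
    proof (rule sum.cong)
      fix i assume "i \<in> {0..<n}"
      then show "x $ i * (A *\<^sub>v x) $ i
        = of_bool (vs ! i \<in> B) * real (card {w \<in> B. {vs ! i, w} \<in> E})"
        by (simp only: Ax atLeastLessThan_iff) (simp add: x_def)
    qed simp
    finally show ?thesis .
  qed
  also have "\<dots> = (\<Sum>v\<in>V. of_bool (v \<in> B) * real (card {w \<in> B. {v, w} \<in> E}))"
    by (rule sum_vs)
  also have "\<dots> = (\<Sum>v\<in>B. real (card {w \<in> B. {v, w} \<in> E}))"
    using B finV by (intro sum.mono_neutral_cong_right) auto
  finally show ?thesis
    using bound by (simp add: xu xx uu es0 power2_eq_square algebra_simps)
qed

text \<open>For \<open>n = 1\<close> the condition on the eigenvalues is vacuous and
  \<open>lam\<close> could be negative. A positive degree forces an edge, hence two vertices, and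
  then \<open>lam\<close> bounds some absolute value.\<close>

lemma ndl_graph_lam_nonneg:
  assumes G: "ndl_graph V E n d lam" and "0 < d"
  shows "0 \<le> lam"
proof -
  from G have simple: "simple_graph V E" and cardV: "card V = n" and n: "0 < n"
    and reg: "regular_graph V E d"
    unfolding ndl_graph_def by auto
  obtain v where "v \<in> V" using cardV n by fastforce
  then have "degree_in E v \<noteq> 0" using reg \<open>0 < d\<close> by (simp add: regular_graph_def)
  then obtain e where "e \<in> E" unfolding degree_in_def by (metis (no_types, lifting) card.empty empty_Collect_eq)
  then have "e \<subseteq> V" "card e = 2" "finite V"
    using simple by (auto simp: simple_graph_def nsets_def)
  then have "1 < n" using card_mono[of V e] cardV by simp
  with G have "\<exists>a. \<bar>a\<bar> \<le> lam" unfolding ndl_graph_def by (metis atLeastLessThan_iff order_refl)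
  then show ?thesis by (meson abs_ge_zero order_trans)
qed

section \<open>The clique bound and its case of edges\<close>

theorem proposition3p2:
  fixes V B :: "'a set" and E :: "'a set set" and n d m :: nat and lam :: real
  assumes "ndl_graph V E n d lam"
    and "B \<subseteq> V" and "card B = m"
  shows "(\<forall>i\<ge>2. real (clique_count E i B)
                 \<le> real m / fact i * (real d * theta n d lam B) ^ (i - 1))
       \<and> clique_count E 2 B = edges_within E B
       \<and> real (edges_within E B)
           \<le> real d * real m / 2 * (real m / real n + lam / real d)"
proof -
  note G = assms(1)
  have simple: "simple_graph V E" and n: "0 < n" and reg: "regular_graph V E d"
    using G by (auto simp: ndl_graph_def)
  have finV: "finite V" and irrefl: "\<And>v. {v} \<notin> E"
    using simple by (auto simp: simple_graph_def nsets_def)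
  have main: "real (clique_count E i B) \<le> real m / fact i * (real d * theta n d lam B) ^ (i - 1)"
    if i: "2 \<le> i" for i
  \<comment> \<open>For \<open>d = 0\<close> the product of \<open>d\<close> and theta no longer
    contains \<open>lam\<close>, and \<open>lam\<close> may be negative. Both sides are then zero:
    there are no edges, and the exponent \<open>i - 1\<close> is positive.\<close>
  proof (cases "d = 0")
    case True
    have "E = {}"
    proof (rule ccontr)
      assume "E \<noteq> {}"
      then obtain e where e: "e \<in> E" by blast
      then have "e \<subseteq> V" "e \<noteq> {}"
        using simple by (auto simp: simple_graph_def nsets_def)
      then obtain v where v: "v \<in> e" "v \<in> V" by blast
      \<comment> \<open>Needed because \<open>card\<close> of an infinite set is 0, so that degree
        zero alone would not exclude an incident edge.\<close>
      have "finite E"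
        using simple finite_subset[OF _ finite_imp_finite_nsets[OF finV]]
        by (auto simp: simple_graph_def)
      then have "degree_in E v \<noteq> 0" using e v by (auto simp: degree_in_def)
      then show False using reg v True by (simp add: regular_graph_def)
    qed
    have "\<not> (card K = i \<and> clique K E)" for K
    proof
      assume K: "card K = i \<and> clique K E"
      then have "\<not> is_singleton K" "K \<noteq> {}" using i by (auto simp: is_singleton_altdef)
      then obtain a b where "a \<in> K" "b \<in> K" "a \<noteq> b" by (metis is_singletonI')
      with K \<open>E = {}\<close> show False by (auto simp: clique_def)
    qed
    then have "{K. K \<subseteq> B \<and> card K = i \<and> clique K E} = {}" by blast
    then have "clique_count E i B = 0" by (simp only: clique_count_def card.empty)
    then show ?thesis using True i by (simp add: power_0_left)
  next
    case False
    then have lam: "0 \<le> lam" using ndl_graph_lam_nonneg[OF G] by simp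
    obtain k where k: "i = Suc k" using i by (cases i) auto
    \<comment> \<open>Cancelling \<open>d\<close> in \<open>lam / d\<close> needs \<open>d\<close>
      non-zero; the result has the shape used in the mixing bound.\<close>
    have "real d * theta n d lam B = real d / n * card B + lam"
      using False by (simp add: theta_def distrib_left)
    then show ?thesis
      using clique_count_le[OF finV irrefl _ lam expander_mixing[OF G lam] assms(2), of k] assms(3)
      by (simp add: k del: fact_Suc)
  qed
  have two: "clique_count E 2 B = edges_within E B" by (rule clique_count_2[OF simple])
  have "real (edges_within E B) \<le> real d * real m / 2 * (real m / real n + lam / real d)"
    using main[of 2] assms(3) by (simp add: two theta_def fact_2 mult_ac)
  with main two show ?thesis by blast
qed

end
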